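(* Let $n\ge3$, $i\in\{0,1,2\}$, let $D^i_n$ be the set of the four neighbors in the graph $V_n$ of the point $F_{i-1}(q_{i+1})\in V_1\setminus V_0$ (indices mod 3), and let $c^n_{x,y}$ be the conductances of the set $V_n\setminus V_{n-1}$. Let $a,b\in D^i_n$ and let $d$ be the graph distance in $V_n$. If $d(a,b)=1$ then $c^n_{a,b}=\left(\frac53\right)^n\frac54$. If $d(a,b)=2$ then $c^n_{a,b}=\left(\frac53\right)^n\frac14$.
   Context: Let $q_0,q_1,q_2$ be the vertices of an equilateral triangle in the plane, $F_i(x)=\frac12(x+q_i)$, and let $SG$ (the Sierpinski gasket) be the unique nonempty compact set with $SG=\bigcup_{i}F_i(SG)$. For a word $w$ of length $m$ let $F_w=F_{w_1}\circ\cdots\circ F_{w_m}$. Put $V_0=\{q_0,q_1,q_2\}$, $V_m=\bigcup_iF_iV_{m-1}$; $x\sim_m y$ means $x\ne y$ and $x,y\in F_wV_0$ for some word $w$ of length $m$. $V_m$ is regarded as a graph with edge relation $\sim_m$. The energy of a continuous $u:SG\to\mathbb{R}$ is $\mathcal{E}(u)=\lim_{m\to\infty}\left(\frac53\right)^m\sum_{\{x,y\}:x\sim_m y}(u(x)-u(y))^2$ (a nondecreasing limit), and $\operatorname{dom}\mathcal{E}$ is the set of continuous $u$ with $\mathcal{E}(u)<\infty$. For a nonempty set $A\subset V_m$ and values prescribed on $A$, there is a unique $u\in\operatorname{dom}\mathcal{E}$ of least energy with these values on $A$, and its energy has the form $\mathcal{E}(u)=\sum_{\{x,y\}\subset A}c_{x,y}(u(x)-u(y))^2$;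 the (uniquely determined, symmetric) coefficients $c_{x,y}$, $x\neq y$, are the conductances of $A$. *)

theory Defs
  imports "HOL-Analysis.Analysis" "HOL-Library.Extended_Nat"
begin

text \<open>
  The index set \<open>{0, 1, 2}\<close> is the numeral type \<open>3\<close>, whose arithmetic is arithmetic modulo 3.
  Every notion takes the corners \<open>q\<close> of the triangle as its first argument.
\<close>

definition equilateral :: "(3 \<Rightarrow> real^2) \<Rightarrow> bool" where
  "equilateral q \<longleftrightarrow> (\<exists>s>0. \<forall>i j. i \<noteq> j \<longrightarrow> dist (q i) (q j) = s)"

definition sg_map :: "(3 \<Rightarrow> real^2) \<Rightarrow> 3 \<Rightarrow> real^2 \<Rightarrow> real^2" where
  "sg_map q i x = (1/2) *\<^sub>R (x + q i)"

definition sierpinski_gasket :: "(3 \<Rightarrow> real^2) \<Rightarrow> (real^2) set" where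
  "sierpinski_gasket q =
     (THE K. K \<noteq> {} \<and> compact K \<and> K = (\<Union>i. sg_map q i ` K))"

fun sg_word_map :: "(3 \<Rightarrow> real^2) \<Rightarrow> 3 list \<Rightarrow> real^2 \<Rightarrow> real^2" where
  "sg_word_map q [] = id"
| "sg_word_map q (i # w) = sg_map q i \<circ> sg_word_map q w"

fun sg_vertices :: "(3 \<Rightarrow> real^2) \<Rightarrow> nat \<Rightarrow> (real^2) set" where
  "sg_vertices q 0 = range q"
| "sg_vertices q (Suc m) = (\<Union>i. sg_map q i ` sg_vertices q m)"

definition sg_adj :: "(3 \<Rightarrow> real^2) \<Rightarrow> nat \<Rightarrow> real^2 \<Rightarrow> real^2 \<Rightarrow> bool" where
  "sg_adj q m x y \<longleftrightarrow>
     x \<noteq> y \<and>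
     (\<exists>w. length w = m \<and> x \<in> sg_word_map q w ` sg_vertices q 0
                      \<and> y \<in> sg_word_map q w ` sg_vertices q 0)"

text \<open>The distance is \<open>\<infinity>\<close> if no path exists.\<close>

definition sg_graph_dist :: "(3 \<Rightarrow> real^2) \<Rightarrow> nat \<Rightarrow> real^2 \<Rightarrow> real^2 \<Rightarrow> enat" where
  "sg_graph_dist q m x y = (INF k \<in> {k. (sg_adj q m ^^ k) x y}. enat k)"

text \<open>
  Sums over unordered pairs are written as half the sum over ordered pairs.
  Functions on the gasket are total functions on the plane; only their values on the gasket matter.
\<close>

definition sg_graph_energy :: "(3 \<Rightarrow> real^2) \<Rightarrow> nat \<Rightarrow> (real^2 \<Rightarrow> real) \<Rightarrow> real" where
  "sg_graph_energy q m u =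
     (5/3) ^ m * ((\<Sum>(x, y) \<in> {(x, y). sg_adj q m x y}. (u x - u y)\<^sup>2) / 2)"

definition sg_energy :: "(3 \<Rightarrow> real^2) \<Rightarrow> (real^2 \<Rightarrow> real) \<Rightarrow> ereal" where
  "sg_energy q u = lim (\<lambda>m. ereal (sg_graph_energy q m u))"

definition sg_dom_energy :: "(3 \<Rightarrow> real^2) \<Rightarrow> (real^2 \<Rightarrow> real) set" where
  "sg_dom_energy q = {u. continuous_on (sierpinski_gasket q) u \<and> sg_energy q u < \<infinity>}"

text \<open>\<open>u\<close> has least energy among all functions with the same values on \<open>A\<close>.\<close>

definition sg_energy_minimizer ::
  "(3 \<Rightarrow> real^2) \<Rightarrow> (real^2) set \<Rightarrow> (real^2 \<Rightarrow> real) \<Rightarrow> bool" where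
  "sg_energy_minimizer q A u \<longleftrightarrow>
     u \<in> sg_dom_energy q \<and>
     (\<forall>v \<in> sg_dom_energy q. (\<forall>x\<in>A. v x = u x) \<longrightarrow> sg_energy q u \<le> sg_energy q v)"

text \<open>
  The conductances are only meaningful at pairs of distinct points of \<open>A\<close>; they are set to \<open>0\<close>
  elsewhere so that the description picks out a unique function.
\<close>

definition sg_conductance ::
  "(3 \<Rightarrow> real^2) \<Rightarrow> (real^2) set \<Rightarrow> real^2 \<Rightarrow> real^2 \<Rightarrow> real" where
  "sg_conductance q A =
     (THE c. (\<forall>x y. c x y = c y x)
           \<and> (\<forall>x y. \<not> (x \<in> A \<and> y \<in> A \<and> x \<noteq> y) \<longrightarrow> c x y = 0)
           \<and> (\<forall>u. sg_energy_minimizer q A u \<longrightarrow>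
                sg_energy q u = ereal ((\<Sum>x\<in>A. \<Sum>y\<in>A. c x y * (u x - u y)\<^sup>2) / 2)))"

definition sg_midpoint_nbrs :: "(3 \<Rightarrow> real^2) \<Rightarrow> nat \<Rightarrow> 3 \<Rightarrow> (real^2) set" where
  "sg_midpoint_nbrs q n i = {x. sg_adj q n (sg_map q (i - 1) (q (i + 1))) x}"

end

theory Submission
  imports Defs
begin

text \<open>
  The points of $V_{n-1}$ are pairwise non-adjacent in the graph $V_n$, so the minimal energy for given
  values on $V_n \setminus V_{n-1}$ arises by giving each $z \in V_{n-1}$ the mean value of its neighbors
  (the star-mesh transform): $z$ contributes $(5/3)^n / \deg z$ to the conductance of every pair of its
  neighbors. Two distinct neighbors of a midpoint $p \in V_1$ have no common neighbor in $V_{n-1}$ besides $p$,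
  and $\deg p = 4$; hence the value $(5/3)^n (1 + 1/4)$ for adjacent and $(5/3)^n / 4$ for non-adjacent pairs.

  Passing from $V_n$ to the gasket needs that every function on $V_n$ extends continuously with the same
  energy. The harmonic extension is given by the $1/5$-$2/5$ rule; it contracts oscillations by $3/5$ on each
  cell, which makes it uniformly continuous on $\bigcup_m V_m$, hence extendable to the whole plane. So nothing
  need be known about the gasket itself, not even its existence.
\<close>

section \<open>Star-mesh transform of a finite network\<close>

text \<open>Variance decomposition around the mean. For a star of unit conductances with centre
  value \<open>t\<close>, the first term is the cost of deviating from the mean, the second is what
  remains once the centre is eliminated.\<close>

lemma sum_squared_deviations:
  fixes f :: "'a \<Rightarrow> real"
  assumes "finite N"
  shows "(\<Sum>a\<in>N. (t - f a)\<^sup>2) =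
    card N * (t - (\<Sum>a\<in>N. f a) / card N)\<^sup>2 + (\<Sum>a\<in>N. \<Sum>b\<in>N. (f a - f b)\<^sup>2) / (2 * card N)"
proof (cases "N = {}")
  case False
  define c where "c = real (card N)"
  have c: "c > 0" using False assms by (simp add: c_def card_gt_0_iff)
  define S where "S = (\<Sum>a\<in>N. f a)"
  define Q where "Q = (\<Sum>a\<in>N. (f a)\<^sup>2)"
  have 1: "(\<Sum>a\<in>N. (t - f a)\<^sup>2) = c * t\<^sup>2 - 2 * t * S + Q" for t
    by (simp add: power2_diff sum.distrib sum_subtractf sum_distrib_left c_def S_def Q_def mult.assoc)
  have 2: "(\<Sum>a\<in>N. \<Sum>b\<in>N. (f a - f b)\<^sup>2) = 2 * c * Q - 2 * S\<^sup>2"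
  proof -
    have "(\<Sum>a\<in>N. \<Sum>b\<in>N. (f a - f b)\<^sup>2) = c * Q - 2 * S * S + c * Q"
      unfolding 1 by (simp add: sum.distrib sum_subtractf sum_distrib_left[symmetric] sum_distrib_right[symmetric]
        c_def[symmetric] S_def[symmetric] Q_def[symmetric])
    then show ?thesis by (simp add: power2_eq_square)
  qed
  show ?thesis unfolding 2 unfolding 1 using c
    by (simp add: S_def[symmetric] c_def[symmetric] power2_eq_square field_simps)
qed simp

text \<open>A star of \<open>d\<close> unit conductances is equivalent to the complete graph on its
  tips with conductance \<open>1/d\<close> for each pair. Diagonal values may be nonzero; in the
  quadratic form they are multiplied by \<open>0\<close>.\<close>

definition mesh_conductance :: "('a \<Rightarrow> 'a \<Rightarrow> bool) \<Rightarrow> 'a set \<Rightarrow> 'a set \<Rightarrow> 'a \<Rightarrow> 'a \<Rightarrow> real" where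
  "mesh_conductance adj A B x y =
     of_bool (adj x y) + (\<Sum>z\<in>B. of_bool (adj z x \<and> adj z y) / card {a\<in>A. adj z a})"

text \<open>As \<open>B\<close> is independent, every edge lies inside \<open>A\<close> or in
  exactly one star with centre in \<open>B\<close>, and \<open>sum_squared_deviations\<close> treats
  each star separately. The identity holds for every \<open>f\<close>; its last sum is nonnegative
  and vanishes when \<open>f\<close> takes the neighbor mean at each point of
  \<open>B\<close>.\<close>

lemma star_mesh:
  fixes f :: "'a \<Rightarrow> real"
  assumes fin: "finite A" "finite B" and disj: "A \<inter> B = {}"
    and sym: "\<And>x y. adj x y \<longleftrightarrow> adj y x"
    and vert: "\<And>x y. adj x y \<Longrightarrow> x \<in> A \<union> B"
    and indep: "\<And>x y. \<lbrakk>x \<in> B; y \<in> B\<rbrakk> \<Longrightarrow> \<not> adj x y"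
  shows "(\<Sum>(x, y)\<in>{(x, y). adj x y}. (f x - f y)\<^sup>2) / 2 =
    (\<Sum>x\<in>A. \<Sum>y\<in>A. mesh_conductance adj A B x y * (f x - f y)\<^sup>2) / 2 +
    (\<Sum>z\<in>B. card {a\<in>A. adj z a} * (f z - (\<Sum>a | a \<in> A \<and> adj z a. f a) / card {a\<in>A. adj z a})\<^sup>2)"
proof -
  define N where "N z = {a\<in>A. adj z a}" for z
  define e where "e x y = of_bool (adj x y) * (f x - f y)\<^sup>2" for x y
  have finN: "finite (N z)" for z using fin by (simp add: N_def)
  have "{(x, y). adj x y} = {p \<in> (A \<union> B) \<times> (A \<union> B). adj (fst p) (snd p)}"
    using vert sym by auto
  then have "(\<Sum>(x, y)\<in>{(x, y). adj x y}. (f x - f y)\<^sup>2) = (\<Sum>p\<in>(A \<union> B) \<times> (A \<union> B). e (fst p) (snd p))"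
    using fin by (simp add: e_def sum.inter_filter case_prod_unfold of_bool_def if_distrib[of "\<lambda>c. c * _"] cong: if_cong)
  also have "\<dots> = (\<Sum>x\<in>A \<union> B. \<Sum>y\<in>A \<union> B. e x y)"
    by (simp add: sum.cartesian_product case_prod_unfold)
  also have "\<dots> = (\<Sum>x\<in>A. \<Sum>y\<in>A. e x y) + (\<Sum>x\<in>A. \<Sum>y\<in>B. e x y) + (\<Sum>x\<in>B. \<Sum>y\<in>A. e x y) + (\<Sum>x\<in>B. \<Sum>y\<in>B. e x y)"
    using fin disj by (simp add: sum.union_disjoint sum.distrib)
  also have "(\<Sum>x\<in>B. \<Sum>y\<in>B. e x y) = 0" using indep by (simp add: e_def)
  also have "(\<Sum>x\<in>A. \<Sum>y\<in>B. e x y) = (\<Sum>x\<in>B. \<Sum>y\<in>A. e x y)"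
    using sym by (subst sum.swap) (simp add: e_def power2_commute)
  finally have edges: "(\<Sum>(x, y)\<in>{(x, y). adj x y}. (f x - f y)\<^sup>2) = (\<Sum>x\<in>A. \<Sum>y\<in>A. e x y) + 2 * (\<Sum>z\<in>B. \<Sum>a\<in>A. e z a)"
    by simp
  have star: "(\<Sum>a\<in>A. e z a) = card (N z) * (f z - (\<Sum>a\<in>N z. f a) / card (N z))\<^sup>2
     + (\<Sum>a\<in>A. \<Sum>b\<in>A. of_bool (adj z a \<and> adj z b) / card (N z) * (f a - f b)\<^sup>2) / 2" for z
  proof -
    have "(\<Sum>a\<in>A. e z a) = (\<Sum>a\<in>N z. (f z - f a)\<^sup>2)"
      using fin by (simp add: e_def N_def sum.inter_filter of_bool_def if_distrib[of "\<lambda>c. c * _"] cong: if_cong)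
    also have "\<dots> = card (N z) * (f z - (\<Sum>a\<in>N z. f a) / card (N z))\<^sup>2
        + (\<Sum>a\<in>N z. \<Sum>b\<in>N z. (f a - f b)\<^sup>2) / (2 * card (N z))"
      by (rule sum_squared_deviations[OF finN])
    also have "(\<Sum>a\<in>N z. \<Sum>b\<in>N z. (f a - f b)\<^sup>2) = (\<Sum>a\<in>A. \<Sum>b\<in>A. of_bool (adj z a \<and> adj z b) * (f a - f b)\<^sup>2)"
      unfolding N_def sum.inter_filter[OF fin(1)] by (intro sum.cong refl) (auto intro!: sum.cong sum.neutral)
    also have "\<dots> / (2 * card (N z)) = (\<Sum>a\<in>A. \<Sum>b\<in>A. of_bool (adj z a \<and> adj z b) / card (N z) * (f a - f b)\<^sup>2) / 2"
      by (simp add: sum_divide_distrib mult.commute)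
    finally show ?thesis .
  qed
  have "(\<Sum>z\<in>B. \<Sum>a\<in>A. \<Sum>b\<in>A. of_bool (adj z a \<and> adj z b) / card (N z) * (f a - f b)\<^sup>2) =
     (\<Sum>a\<in>A. \<Sum>b\<in>A. (\<Sum>z\<in>B. of_bool (adj z a \<and> adj z b) / card (N z)) * (f a - f b)\<^sup>2)"
    by (simp add: sum_distrib_right sum.swap[of _ A B])
  then have "(\<Sum>x\<in>A. \<Sum>y\<in>A. e x y) + (\<Sum>z\<in>B. \<Sum>a\<in>A. \<Sum>b\<in>A. of_bool (adj z a \<and> adj z b) / card (N z) * (f a - f b)\<^sup>2)
    = (\<Sum>x\<in>A. \<Sum>y\<in>A. mesh_conductance adj A B x y * (f x - f y)\<^sup>2)"
    by (simp add: mesh_conductance_def N_def e_def sum.distrib[symmetric] distrib_right)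
  moreover have "(\<Sum>z\<in>B. \<Sum>a\<in>A. e z a) = (\<Sum>z\<in>B. card (N z) * (f z - (\<Sum>a\<in>N z. f a) / card (N z))\<^sup>2)
     + (\<Sum>z\<in>B. \<Sum>a\<in>A. \<Sum>b\<in>A. of_bool (adj z a \<and> adj z b) / card (N z) * (f a - f b)\<^sup>2) / 2"
    unfolding star sum.distrib sum_divide_distrib ..
  ultimately show ?thesis
    unfolding edges N_def by simp
qed

lemma mesh_conductance_commute:
  assumes "\<And>x y. adj x y \<longleftrightarrow> adj y x"
  shows "mesh_conductance adj A B x y = mesh_conductance adj A B y x"
  using assms[of x y] by (simp add: mesh_conductance_def conj_commute)

text \<open>Polarization: the form at the indicator of two points, minus the forms at the two single
  indicators, isolates one coefficient.\<close>

lemma quadratic_form_determines_conductances: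
  fixes c c' :: "'a \<Rightarrow> 'a \<Rightarrow> real"
  assumes fin: "finite A" and sym: "\<And>x y. c x y = c y x" "\<And>x y. c' x y = c' y x"
    and eq: "\<And>f. (\<Sum>x\<in>A. \<Sum>y\<in>A. c x y * (f x - f y)\<^sup>2) = (\<Sum>x\<in>A. \<Sum>y\<in>A. c' x y * (f x - f y :: real)\<^sup>2)"
    and ab: "a \<in> A" "b \<in> A" "a \<noteq> b"
  shows "c a b = c' a b"
proof -
  define D where "D x y = c x y - c' x y" for x y
  define G where "G f = (\<Sum>x\<in>A. \<Sum>y\<in>A. D x y * (f x - f y :: real)\<^sup>2)" for f
  have G0: "G f = 0" for f
    using eq[of f] by (simp add: G_def D_def left_diff_distrib sum_subtractf)
  define d where "d a x = (of_bool (x = a) :: real)" for a x :: 'a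
  have pt: "(\<Sum>x\<in>A. \<Sum>y\<in>A. D x y * (d a x * d b y)) = D a b" if "a \<in> A" "b \<in> A" for a b
    using fin that by (simp add: d_def of_bool_def if_distrib[of "\<lambda>c. c * _"] if_distrib[of "\<lambda>c. _ * c"] cong: if_cong)
  have disjoint: "d a x * d b x = 0" for x using ab by (simp add: d_def)
  \<comment> \<open>The indicators have disjoint supports, so their products at a common point drop
    out of the expansion.\<close>
  have id: "(d a x + d b x - (d a y + d b y))\<^sup>2 = (d a x - d a y)\<^sup>2 + (d b x - d b y)\<^sup>2 - 2 * (d a x * d b y) - 2 * (d b x * d a y)" for x y
    using disjoint[of x] disjoint[of y] by algebra
  have "G (\<lambda>x. d a x + d b x) = G (d a) + G (d b) 
    - 2 * (\<Sum>x\<in>A. \<Sum>y\<in>A. D x y * (d a x * d b y)) - 2 * (\<Sum>x\<in>A. \<Sum>y\<in>A. D x y * (d b x * d a y))"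
    unfolding G_def id
    by (simp add: algebra_simps sum.distrib sum_subtractf sum_distrib_left)
  then have "D a b + D b a = 0" using G0 pt ab by simp
  then show ?thesis using sym[of a b] by (simp add: D_def)
qed

section \<open>Barycentric coordinates\<close>

lemma UNIV_type_3: "(UNIV :: 3 set) = {0, 1, 2}"
proof -
  have "(3::3) = 0" by simp
  then show ?thesis using UNIV_3 by auto
qed

lemma sum_type_3: "sum f (UNIV :: 3 set) = f 0 + f 1 + (f 2 :: 'a::comm_monoid_add)"
  unfolding UNIV_type_3 by (simp add: ac_simps)

lemma forall_type_3: "(\<forall>i::3. P i) \<longleftrightarrow> P 0 \<and> P 1 \<and> P 2"
  by (metis UNIV_type_3 UNIV_I empty_iff insertE)

locale equilateral_triangle =
  fixes q :: "3 \<Rightarrow> real^2"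
  assumes equilateral: "equilateral q"
begin

abbreviation F :: "3 \<Rightarrow> real^2 \<Rightarrow> real^2" where "F \<equiv> sg_map q"

definition side :: real where "side = dist (q 0) (q 1)"

definition centroid :: "real^2" where "centroid = (1/3) *\<^sub>R (\<Sum>i\<in>UNIV. q i)"

text \<open>The affine function that is \<open>1\<close> at \<open>q j\<close> and \<open>0\<close>
  at the other corners: the inner product equals \<open>side\<^sup>2 / 3\<close> at
  \<open>q j\<close> and \<open>- side\<^sup>2 / 6\<close> at the other two.\<close>

definition bary :: "3 \<Rightarrow> real^2 \<Rightarrow> real" where
  "bary j x = 1/3 + 2 / side\<^sup>2 * ((x - centroid) \<bullet> (q j - centroid))"

lemma side_pos: "side > 0" and dist_q: "i \<noteq> j \<Longrightarrow> dist (q i) (q j) = side"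
proof -
  obtain s where s: "s > 0" "\<And>i j. i \<noteq> j \<Longrightarrow> dist (q i) (q j) = s"
    using equilateral unfolding equilateral_def by blast
  have "side = s" unfolding side_def by (rule s(2)) simp
  then show "side > 0" "i \<noteq> j \<Longrightarrow> dist (q i) (q j) = side" using s by auto
qed

lemma inner_q: assumes "i \<noteq> j" shows "2 * (q i \<bullet> q j) = q i \<bullet> q i + q j \<bullet> q j - side\<^sup>2"
proof -
  have "side\<^sup>2 = (q i - q j) \<bullet> (q i - q j)"
    using dist_q[OF assms] by (simp add: dist_norm power2_norm_eq_inner[symmetric])
  then show ?thesis by (simp add: inner_diff_left inner_diff_right inner_commute)
qed

lemma bary_q: "bary j (q k) = (if j = k then 1 else 0)"
proof -
  have c: "centroid = (1/3) *\<^sub>R (q 0 + q 1 + q 2)" by (simp add: centroid_def sum_type_3)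
  have i: "2 * (q 0 \<bullet> q 1) = q 0 \<bullet> q 0 + q 1 \<bullet> q 1 - side\<^sup>2" "2 * (q 0 \<bullet> q 2) = q 0 \<bullet> q 0 + q 2 \<bullet> q 2 - side\<^sup>2"
    "2 * (q 1 \<bullet> q 2) = q 1 \<bullet> q 1 + q 2 \<bullet> q 2 - side\<^sup>2" by (rule inner_q, simp)+
  have "\<forall>j. \<forall>k. (q k - centroid) \<bullet> (q j - centroid) = (if j = k then side\<^sup>2 / 3 else - side\<^sup>2 / 6)"
    unfolding forall_type_3 c using i
    by (simp add: inner_simps inner_commute[of "q 1" "q 0"] inner_commute[of "q 2" "q 0"] inner_commute[of "q 2" "q 1"] field_simps)
  then show ?thesis using side_pos by (simp add: bary_def)
qed

lemma bary_F: "bary j (F i x) = (bary j x + (if j = i then 1 else 0)) / 2"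
proof -
  have "bary j (F i x) = (bary j x + bary j (q i)) / 2"
    by (simp add: bary_def sg_map_def inner_simps add_divide_distrib diff_divide_distrib algebra_simps)
  then show ?thesis by (auto simp: bary_q)
qed

lemma bary_lipschitz: "\<exists>L>0. \<forall>j x y. \<bar>bary j x - bary j y\<bar> \<le> L * dist x y"
proof -
  \<comment> \<open>Summing over all corners makes \<open>L\<close> independent of \<open>j\<close>;
    the summand \<open>1\<close> makes it positive.\<close>
  define L where "L = 2 / side\<^sup>2 * (\<Sum>j\<in>UNIV. norm (q j - centroid)) + 1"
  have "\<bar>bary j x - bary j y\<bar> \<le> L * dist x y" for j x y
  proof -
    have "bary j x - bary j y = 2 / side\<^sup>2 * ((x - y) \<bullet> (q j - centroid))"
      by (simp add: bary_def inner_simps right_diff_distrib add_divide_distrib diff_divide_distrib)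
    then have "\<bar>bary j x - bary j y\<bar> = 2 / side\<^sup>2 * \<bar>(x - y) \<bullet> (q j - centroid)\<bar>"
      by (simp add: abs_mult)
    also have "\<dots> \<le> 2 / side\<^sup>2 * (norm (x - y) * norm (q j - centroid))"
      by (intro mult_left_mono Cauchy_Schwarz_ineq2) simp
    also have "\<dots> \<le> 2 / side\<^sup>2 * (norm (x - y) * (\<Sum>j\<in>UNIV. norm (q j - centroid)))"
      by (intro mult_left_mono member_le_sum) auto
    also have "\<dots> \<le> L * dist x y" by (simp add: L_def dist_norm algebra_simps)
    finally show ?thesis .
  qed
  moreover have "L > 0" unfolding L_def by (intro add_nonneg_pos mult_nonneg_nonneg sum_nonneg) auto
  ultimately show ?thesis by blast
qed

text \<open>The last conjunct makes points determined by their coordinates without an argument on dimension.\<close>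

definition triangle :: "(real^2) set" where
  "triangle = {x. (\<forall>j. bary j x \<ge> 0) \<and> (\<Sum>j\<in>UNIV. bary j x) = 1 \<and> x = (\<Sum>j\<in>UNIV. bary j x *\<^sub>R q j)}"

lemma q_in_triangle: "q i \<in> triangle"
  by (simp add: triangle_def bary_q if_distrib[of "\<lambda>c. c *\<^sub>R _"] cong: if_cong)

lemma F_in_triangle: assumes "x \<in> triangle" shows "F i x \<in> triangle"
proof -
  have x: "\<And>j. bary j x \<ge> 0" "(\<Sum>j\<in>UNIV. bary j x) = 1" "(\<Sum>j\<in>UNIV. bary j x *\<^sub>R q j) = x"
    using assms by (auto simp: triangle_def)
  have "(\<Sum>j\<in>UNIV. bary j (F i x)) = ((\<Sum>j\<in>UNIV. bary j x) + 1) / 2"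
    unfolding bary_F by (simp add: sum_divide_distrib[symmetric] sum.distrib)
  moreover have "(\<Sum>j\<in>UNIV. bary j (F i x) *\<^sub>R q j) = (1/2) *\<^sub>R ((\<Sum>j\<in>UNIV. bary j x *\<^sub>R q j) + (\<Sum>j\<in>UNIV. (if j = i then 1 else 0) *\<^sub>R q j))"
    unfolding bary_F scaleR_sum_right sum.distrib[symmetric]
    by (intro sum.cong) (auto simp: add_divide_distrib scaleR_add_left scaleR_add_right)
  moreover have "(\<Sum>j\<in>UNIV. (if j = i then 1 else 0) *\<^sub>R q j) = q i"
    by (simp add: if_distrib[of "\<lambda>c. c *\<^sub>R _"] cong: if_cong)
  ultimately show ?thesis using x by (auto simp: triangle_def sg_map_def bary_F[unfolded sg_map_def])
qed

lemma triangle_eqI: "\<lbrakk>x \<in> triangle; y \<in> triangle; \<And>j. bary j x = bary j y\<rbrakk> \<Longrightarrow> x = y"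
  unfolding triangle_def by (metis (mono_tags, lifting) mem_Collect_eq sum.cong)

lemma bary_nonneg: "x \<in> triangle \<Longrightarrow> bary j x \<ge> 0" and bary_le_1: "x \<in> triangle \<Longrightarrow> bary j x \<le> 1"
proof -
  show 0: "x \<in> triangle \<Longrightarrow> bary j x \<ge> 0" for j by (simp add: triangle_def)
  show "x \<in> triangle \<Longrightarrow> bary j x \<le> 1"
    using member_le_sum[of j UNIV "\<lambda>j. bary j x"] 0 by (auto simp: triangle_def)
qed

lemma bary_add_le_1: assumes "x \<in> triangle" "j \<noteq> k" shows "bary j x + bary k x \<le> 1"
proof -
  have "(\<Sum>l\<in>{j,k}. bary l x) \<le> (\<Sum>l\<in>UNIV. bary l x)"
    by (rule sum_mono2) (use assms bary_nonneg in auto)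
  moreover have "(\<Sum>l\<in>UNIV. bary l x) = 1" using assms(1) unfolding triangle_def by blast
  ultimately show ?thesis using assms(2) by simp
qed

lemma eq_corner: assumes "x \<in> triangle" "bary j x = 1" shows "x = q j"
proof (rule triangle_eqI[OF assms(1) q_in_triangle])
  fix k
  have "bary k x = 0" if "k \<noteq> j"
    using bary_add_le_1[OF assms(1), of j k] bary_nonneg[OF assms(1), of k] assms(2) that by simp
  then show "bary k x = bary k (q j)" using assms by (auto simp: bary_q)
qed

lemma F_inject: "F i x = F i y \<longleftrightarrow> x = y"
  by (simp add: sg_map_def)

lemma inj_F: "inj_on (F i) S"
  by (simp add: inj_on_def F_inject)

lemma inj_q: "inj q"
  using bary_q by (metis injI zero_neq_one)

lemma F_q: "F i (q i) = q i"
  by (simp add: sg_map_def scaleR_2[symmetric])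

lemma F_q_commute: "F i (q j) = F j (q i)"
  by (simp add: sg_map_def add.commute)

text \<open>\<open>bary j\<close> is at most \<open>1/2\<close> on the cell \<open>F i\<close> and
  at least \<open>1/2\<close> on the cell \<open>F j\<close>. So distinct cells share only the
  midpoint \<open>F i (q j)\<close>; later arguments about overlapping cells rest on this.\<close>

lemma F_eq_F_corner:
  assumes "x \<in> triangle" "y \<in> triangle" "F i x = F j y" "i \<noteq> j"
  shows "x = q j"
proof (rule eq_corner[OF assms(1)])
  have "bary j (F i x) = bary j (F j y)" using assms by simp
  then show "bary j x = 1" using assms(4) bary_nonneg[OF assms(2), of j] bary_le_1[OF assms(1), of j]
    by (simp add: bary_F)
qed

section \<open>Graph approximations and their energies\<close>

abbreviation V :: "nat \<Rightarrow> (real^2) set" where "V \<equiv> sg_vertices q"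

lemma vertices_subset_triangle: "V n \<subseteq> triangle"
  by (induction n) (auto simp: q_in_triangle intro: F_in_triangle)

lemma finite_vertices: "finite (V n)"
  by (induction n) auto

lemma vertices_Suc_mono: "V n \<subseteq> V (Suc n)"
proof (induction n)
  case 0
  have "q i \<in> F i ` range q" for i using F_q[of i] by (metis imageI rangeI)
  then show ?case by auto
next
  case (Suc n)
  then show ?case by (simp only: sg_vertices.simps) (intro UN_mono image_mono subset_refl)
qed

lemma vertices_mono: "m \<le> n \<Longrightarrow> V m \<subseteq> V n"
  by (rule lift_Suc_mono_le[of V]) (use vertices_Suc_mono in auto)

lemma q_in_vertices: "q i \<in> V n"
  using vertices_mono[of 0 n] by auto

text \<open>\<open>F i x\<close> may be listed as a vertex of another cell, but then
  \<open>x\<close> is a corner, and corners lie in every \<open>V n\<close>.\<close>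

lemma F_in_vertices_Suc_iff:
  assumes "x \<in> triangle" shows "F i x \<in> V (Suc n) \<longleftrightarrow> x \<in> V n"
proof
  assume "F i x \<in> V (Suc n)"
  then obtain j y where y: "y \<in> V n" "F i x = F j y" by auto
  show "x \<in> V n"
  proof (cases "i = j")
    case True
    then show ?thesis using y F_inject by simp
  next
    case False
    then show ?thesis using F_eq_F_corner[OF assms _ y(2)] y(1) vertices_subset_triangle q_in_vertices by auto
  qed
qed auto

lemma adj_0: "sg_adj q 0 x y \<longleftrightarrow> x \<noteq> y \<and> x \<in> range q \<and> y \<in> range q"
  by (simp add: sg_adj_def)

text \<open>The first letter of a word is the outermost map; peeling it off turns self-similarity
  into a recursion for inductions on the level.\<close>

lemma adj_Suc: "sg_adj q (Suc n) x y \<longleftrightarrow> (\<exists>i x' y'. x = F i x' \<and> y = F i y' \<and> sg_adj q n x' y')"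
proof
  assume "sg_adj q (Suc n) x y"
  then obtain w where w: "x \<noteq> y" "length w = Suc n" "x \<in> sg_word_map q w ` V 0" "y \<in> sg_word_map q w ` V 0"
    unfolding sg_adj_def by blast
  then obtain i w' where "w = i # w'" "length w' = n" by (cases w) auto
  then show "\<exists>i x' y'. x = F i x' \<and> y = F i y' \<and> sg_adj q n x' y'"
    using w unfolding sg_adj_def by (fastforce simp: image_comp[symmetric])
next
  assume "\<exists>i x' y'. x = F i x' \<and> y = F i y' \<and> sg_adj q n x' y'"
  then obtain i x' y' w where "x = F i x'" "y = F i y'" "x' \<noteq> y'" "length w = n"
    "x' \<in> sg_word_map q w ` V 0" "y' \<in> sg_word_map q w ` V 0"
    unfolding sg_adj_def by blast
  then show "sg_adj q (Suc n) x y"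
    unfolding sg_adj_def by (intro conjI exI[of _ "i # w"]) (auto simp: F_inject)
qed

lemma adj_sym: "sg_adj q n x y \<longleftrightarrow> sg_adj q n y x"
  by (auto simp: sg_adj_def)

lemma adj_irrefl: "\<not> sg_adj q n x x"
  by (simp add: sg_adj_def)

lemma adj_in_vertices: "sg_adj q n x y \<Longrightarrow> x \<in> V n \<and> y \<in> V n"
proof (induction n arbitrary: x y)
  case 0
  then show ?case by (simp add: adj_0)
next
  case (Suc n)
  then show ?case by (fastforce simp: adj_Suc)
qed

lemma adj_in_triangle: "sg_adj q n x y \<Longrightarrow> x \<in> triangle" "sg_adj q n x y \<Longrightarrow> y \<in> triangle"
  using adj_in_vertices vertices_subset_triangle by blast+

section \<open>Self-similarity of the graph energies\<close>

definition edges :: "nat \<Rightarrow> ((real^2) \<times> (real^2)) set" where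
  "edges n = {(x, y). sg_adj q n x y}"

lemma finite_edges: "finite (edges n)"
  by (rule finite_subset[of _ "V n \<times> V n"]) (auto simp: edges_def finite_vertices dest: adj_in_vertices)

text \<open>No edge belongs to two cells: both of its ends would be the single point that the cells
  share.\<close>

lemma sum_edges_Suc: "(\<Sum>(x, y)\<in>edges (Suc n). f x y) = (\<Sum>i\<in>UNIV. \<Sum>(x, y)\<in>edges n. f (F i x) (F i y))"
proof -
  have "edges (Suc n) = (\<Union>i. map_prod (F i) (F i) ` edges n)"
    by (fastforce simp: edges_def adj_Suc)
  moreover have "(map_prod (F i) (F i) ` edges n) \<inter> (map_prod (F j) (F j) ` edges n) = {}" if "i \<noteq> j" for i j
  proof (rule ccontr)
    assume "\<not> ?thesis"
    then obtain x y x' y' where a: "sg_adj q n x y" "sg_adj q n x' y'" "F i x = F j x'" "F i y = F j y'"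
      by (auto simp: edges_def)
    then have "x = q j" "y = q j" using that by (metis F_eq_F_corner adj_in_triangle)+
    then show False using a(1) adj_irrefl by auto
  qed
  ultimately have "(\<Sum>(x, y)\<in>edges (Suc n). f x y) = (\<Sum>i\<in>UNIV. \<Sum>(x, y)\<in>map_prod (F i) (F i) ` edges n. f x y)"
    by (simp add: sum.UNION_disjoint finite_edges)
  also have "\<dots> = (\<Sum>i\<in>UNIV. \<Sum>(x, y)\<in>edges n. f (F i x) (F i y))"
  proof (rule sum.cong[OF refl])
    fix i
    have "inj_on (map_prod (F i) (F i)) (edges n)" by (auto simp: inj_on_def F_inject)
    then show "(\<Sum>(x, y)\<in>map_prod (F i) (F i) ` edges n. f x y) = (\<Sum>(x, y)\<in>edges n. f (F i x) (F i y))"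
      by (simp add: sum.reindex case_prod_unfold)
  qed
  finally show ?thesis .
qed

abbreviation energy :: "nat \<Rightarrow> (real^2 \<Rightarrow> real) \<Rightarrow> real" where
  "energy \<equiv> sg_graph_energy q"

lemma energy_edges: "energy n u = (5/3) ^ n * ((\<Sum>(x, y)\<in>edges n. (u x - u y)\<^sup>2) / 2)"
  by (simp add: sg_graph_energy_def edges_def)

lemma energy_cong: assumes "\<And>x. x \<in> V n \<Longrightarrow> u x = v x" shows "energy n u = energy n v"
  unfolding energy_edges using assms adj_in_vertices
  by (intro arg_cong2[where f="(*)"] arg_cong2[where f="(/)"] sum.cong refl) (auto simp: edges_def)

lemma energy_Suc: "energy (Suc n) u = 5/3 * (\<Sum>i\<in>UNIV. energy n (u \<circ> F i))"
  unfolding energy_edges sum_edges_Suc by (simp add: sum_distrib_left sum_divide_distrib mult.assoc)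

section \<open>Energy renormalization and monotonicity\<close>

definition corner_energy :: "(3 \<Rightarrow> real) \<Rightarrow> real" where
  "corner_energy v = (v 0 - v 1)\<^sup>2 + (v 1 - v 2)\<^sup>2 + (v 2 - v 0)\<^sup>2"

lemma energy_0: "energy 0 u = corner_energy (u \<circ> q)"
proof -
  have "edges 0 = {(q 0, q 1), (q 1, q 0), (q 1, q 2), (q 2, q 1), (q 2, q 0), (q 0, q 2)}"
    unfolding edges_def adj_0 UNIV_type_3 using inj_q by (auto simp: inj_eq)
  moreover have "q 0 \<noteq> q 1" "q 1 \<noteq> q 2" "q 2 \<noteq> q 0" "q 1 \<noteq> q 0" "q 2 \<noteq> q 1" "q 0 \<noteq> q 2"
    using inj_q by (auto simp: inj_eq)
  ultimately show ?thesis unfolding energy_edges corner_energy_def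
    by (simp add: power2_commute)
qed

text \<open>
  The values of the harmonic function with corner values \<open>v\<close> at the corners of the cell \<open>F i\<close>: the
  value at the midpoint \<open>F i (q j)\<close> is two fifths of \<open>v i\<close> and of \<open>v j\<close> plus one fifth of the third one.
\<close>

definition cell_values :: "(3 \<Rightarrow> real) \<Rightarrow> 3 \<Rightarrow> 3 \<Rightarrow> real" where
  "cell_values v i j = (if j = i then v i else (v i + v j + (\<Sum>k\<in>UNIV. v k)) / 5)"

lemma cell_values_same: "cell_values v i i = v i"
  by (simp add: cell_values_def)

lemma cell_values_commute: "cell_values v i j = cell_values v j i"
  by (simp add: cell_values_def)

text \<open>One harmonic subdivision multiplies the unscaled energy by \<open>3/5\<close>; the
  factor \<open>5/3\<close> in the energy compensates exactly for this.\<close>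

lemma corner_energy_cell_values: "5/3 * (\<Sum>i\<in>UNIV. corner_energy (cell_values v i)) = corner_energy v"
  by (simp add: corner_energy_def cell_values_def sum_type_3 power2_eq_square field_simps)

text \<open>Write the level-one values as harmonic values plus a deviation \<open>d\<close>. The
  harmonic values are critical for the energy, so the cross terms cancel and only the nonnegative
  energy of \<open>d\<close> is added.\<close>

lemma energy_mono_0: "energy 0 u \<le> energy 1 u"
proof -
  have e1: "energy 1 u = 5/3 * (\<Sum>i\<in>UNIV. corner_energy (u \<circ> F i \<circ> q))"
    using energy_Suc[of 0 u] energy_0 by simp
  define v where "v = u \<circ> q"
  define d where "d i j = u (F i (q j)) - cell_values v i j" for i j
  have dc: "d i j = d j i" for i j using F_q_commute[of i j] cell_values_commute[of v i j] by (simp add: d_def)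
  have d0: "d i i = 0" for i by (simp add: d_def cell_values_same F_q v_def)
  have u: "u \<circ> F i \<circ> q = (\<lambda>j. cell_values v i j + d i j)" for i by (auto simp: d_def)
  have "5/3 * (\<Sum>i\<in>UNIV. corner_energy (u \<circ> F i \<circ> q)) = 
    corner_energy v + 5/3 * (\<Sum>i\<in>UNIV. corner_energy (d i))"
    unfolding u 
    by (simp add: corner_energy_def cell_values_def sum_type_3 d0 dc[of 1 0] dc[of 2 0] dc[of 2 1] power2_eq_square field_simps)
  moreover have "(\<Sum>i\<in>UNIV. corner_energy (d i)) \<ge> 0"
    by (intro sum_nonneg) (simp add: corner_energy_def)
  ultimately show ?thesis unfolding e1 by (simp add: energy_0 v_def)
qed

lemma energy_mono_Suc: "energy n u \<le> energy (Suc n) u"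
proof (induction n arbitrary: u)
  case 0
  then show ?case using energy_mono_0 by simp
next
  case (Suc n)
  then show ?case unfolding energy_Suc[of n u] energy_Suc[of "Suc n" u] by (intro mult_left_mono sum_mono) auto
qed

lemma energy_mono: "m \<le> n \<Longrightarrow> energy m u \<le> energy n u"
  by (rule lift_Suc_mono_le) (use energy_mono_Suc in auto)

text \<open>By monotonicity the \<open>lim\<close> defining \<open>sg_energy\<close> exists in the
  extended reals and is the supremum.\<close>

lemma energy_le_sg_energy: "ereal (energy n u) \<le> sg_energy q u"
proof -
  have "mono (\<lambda>n. ereal (energy n u))" by (auto simp: mono_def energy_mono)
  then have "(\<lambda>n. ereal (energy n u)) \<longlonglongrightarrow> (SUP n. ereal (energy n u))" by (rule LIMSEQ_SUP)
  then show ?thesis unfolding sg_energy_def by (auto simp: limI intro: SUP_upper)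
qed

lemma sg_energy_eqI: assumes "\<And>m. m \<ge> n \<Longrightarrow> energy m u = e" shows "sg_energy q u = ereal e"
  unfolding sg_energy_def
  by (intro limI tendsto_eventually eventually_sequentiallyI[of n]) (simp add: assms)

section \<open>Harmonic extension\<close>

text \<open>
  \<open>2 *\<^sub>R x - q i\<close> is the preimage of \<open>x\<close> under \<open>F i\<close>; for \<open>x\<close> in the triangle the choice of \<open>i\<close> is
  ambiguous only at the three midpoints.
\<close>

definition glue :: "(3 \<Rightarrow> real^2 \<Rightarrow> real) \<Rightarrow> real^2 \<Rightarrow> real" where
  "glue g x = (let i = (SOME i. bary i x \<ge> 1/2) in g i (2 *\<^sub>R x - q i))"

text \<open>If the choice in \<open>glue\<close> falls on some \<open>j\<close> other than
  \<open>i\<close>, then \<open>x = q j\<close>, the argument handed to \<open>g j\<close> is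
  \<open>q i\<close>, and \<open>match\<close> applies.\<close>

lemma glue_F:
  assumes "x \<in> triangle" and match: "\<And>i j. g i (q j) = g j (q i)"
  shows "glue g (F i x) = g i x"
proof -
  define j where "j = (SOME j. bary j (F i x) \<ge> 1/2)"
  have "bary i (F i x) \<ge> 1/2" using bary_nonneg[OF assms(1)] by (simp add: bary_F)
  then have j: "bary j (F i x) \<ge> 1/2" unfolding j_def by (rule someI)
  have glue: "glue g (F i x) = g j (2 *\<^sub>R F i x - q j)" by (simp add: glue_def Let_def j_def)
  show ?thesis
  proof (cases "j = i")
    case True
    then show ?thesis using glue by (simp add: sg_map_def)
  next
    case False
    then have "bary j x = 1" using j bary_le_1[OF assms(1), of j] by (simp add: bary_F)
    then have "x = q j" by (rule eq_corner[OF assms(1)])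
    then show ?thesis using glue match[of i j] by (simp add: sg_map_def)
  qed
qed

text \<open>The 1/5-2/5 rule is applied \<open>m\<close> times, followed by affine interpolation
  inside the cells of level \<open>m\<close>. The values on \<open>V m\<close> are final, see
  \<open>harmonic_approx_stable\<close>.\<close>

primrec harmonic_approx :: "nat \<Rightarrow> (3 \<Rightarrow> real) \<Rightarrow> real^2 \<Rightarrow> real" where
  "harmonic_approx 0 v = (\<lambda>x. \<Sum>j\<in>UNIV. bary j x * v j)"
| "harmonic_approx (Suc m) v = glue (\<lambda>i. harmonic_approx m (cell_values v i))"

text \<open>In the induction step \<open>q j\<close> is read as the fixed point
  \<open>F j (q j)\<close>; the induction hypothesis supplies the matching condition of
  \<open>glue_F\<close>.\<close>

lemma harmonic_approx_q: "harmonic_approx m v (q j) = v j"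
proof (induction m arbitrary: v j)
  case 0
  then show ?case by (simp add: bary_q if_distrib[of "\<lambda>c. c * _"] cong: if_cong)
next
  case (Suc m)
  then have "harmonic_approx (Suc m) v (F j (q j)) = v j"
    by (simp add: glue_F[OF q_in_triangle] cell_values_same cell_values_commute)
  then show ?case by (simp only: F_q)
qed

lemma harmonic_approx_F:
  assumes "x \<in> triangle"
  shows "harmonic_approx (Suc m) v (F i x) = harmonic_approx m (cell_values v i) x"
  by (simp add: glue_F[OF assms] harmonic_approx_q cell_values_commute)

lemma harmonic_approx_stable:
  "\<lbrakk>x \<in> V k; k \<le> m\<rbrakk> \<Longrightarrow> harmonic_approx m v x = harmonic_approx k v x"
proof (induction k arbitrary: m v x)
  case 0
  then show ?case by (auto simp: harmonic_approx_q simp del: harmonic_approx.simps)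
next
  case (Suc k)
  then obtain i y m' where y: "y \<in> V k" "x = F i y" "m = Suc m'" "k \<le> m'"
    by (auto simp: Suc_le_eq dest!: less_imp_Suc_add)
  then have "y \<in> triangle" using vertices_subset_triangle by blast
  then show ?case using Suc.IH[OF y(1,4)] y(2,3) by (simp add: harmonic_approx_F del: harmonic_approx.simps)
qed

definition harmonic :: "(3 \<Rightarrow> real) \<Rightarrow> real^2 \<Rightarrow> real" where
  "harmonic v x = harmonic_approx (LEAST k. x \<in> V k) v x"

lemma harmonic_eq_approx: "x \<in> V k \<Longrightarrow> harmonic v x = harmonic_approx k v x"
  unfolding harmonic_def by (intro harmonic_approx_stable[symmetric]) (auto intro: LeastI Least_le)

lemma harmonic_q: "harmonic v (q j) = v j"
  using harmonic_eq_approx[OF q_in_vertices[of j 0]] by (simp only: harmonic_approx_q)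

definition V_star :: "(real^2) set" where "V_star = (\<Union>n. V n)"

lemma V_star_subset_triangle: "V_star \<subseteq> triangle"
  using vertices_subset_triangle by (auto simp: V_star_def)

lemma q_in_V_star: "q i \<in> V_star"
  using q_in_vertices by (auto simp: V_star_def)

lemma V_star_cell: assumes "x \<in> V_star" obtains i y where "x = F i y" "y \<in> V_star"
proof -
  obtain n where "x \<in> V n" using assms by (auto simp: V_star_def)
  then have "x \<in> V (Suc n)" using vertices_Suc_mono by blast
  then show ?thesis using that by (auto simp: V_star_def)
qed

lemma harmonic_F: assumes "x \<in> V_star" shows "harmonic v (F i x) = harmonic (cell_values v i) x"
proof -
  obtain n where n: "x \<in> V n" using assms by (auto simp: V_star_def)
  then have "F i x \<in> V (Suc n)" by auto
  then show ?thesis using n V_star_subset_triangle assms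
    by (auto simp add: harmonic_eq_approx harmonic_approx_F simp del: harmonic_approx.simps sg_vertices.simps)
qed

text \<open>Maximum principle: each entry of \<open>cell_values\<close> is a convex combination of
  the corner values.\<close>

lemma harmonic_bounds:
  assumes "x \<in> V_star" "\<And>j. lo \<le> v j \<and> v j \<le> hi"
  shows "lo \<le> harmonic v x \<and> harmonic v x \<le> hi"
proof -
  have "x \<in> V n \<Longrightarrow> (\<And>j. lo \<le> v j \<and> v j \<le> hi) \<Longrightarrow> lo \<le> harmonic v x \<and> harmonic v x \<le> hi" for n
  proof (induction n arbitrary: v x)
    case 0
    then show ?case by (auto simp: harmonic_q)
  next
    case (Suc n)
    then obtain i y where y: "y \<in> V n" "x = F i y" by auto
    have "lo \<le> cell_values v i j \<and> cell_values v i j \<le> hi" for j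
      using Suc.prems(2)[of i] Suc.prems(2)[of j] Suc.prems(2)[of 0] Suc.prems(2)[of 1] Suc.prems(2)[of 2]
      by (auto simp: cell_values_def sum_type_3)
    then have "lo \<le> harmonic (cell_values v i) y \<and> harmonic (cell_values v i) y \<le> hi"
      by (rule Suc.IH[OF y(1)])
    moreover have "y \<in> V_star" using y(1) by (auto simp: V_star_def)
    ultimately show ?case using y(2) by (simp add: harmonic_F)
  qed
  then show ?thesis using assms by (auto simp: V_star_def)
qed

text \<open>Between \<open>v i\<close> and the value at a midpoint of its cell the difference is
  \<open>2/5\<close> of one corner difference plus \<open>1/5\<close> of another; between the two
  midpoints it is \<open>1/5\<close> of one.\<close>

lemma cell_values_contract:
  assumes "\<And>j k. \<bar>v j - v k\<bar> \<le> D"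
  shows "\<bar>cell_values v i j - cell_values v i k\<bar> \<le> 3/5 * D"
proof -
  have "v j - v k \<le> D" for j k using assms[of j k] by simp
  note D = this[of 0 1] this[of 1 0] this[of 0 2] this[of 2 0] this[of 1 2] this[of 2 1]
  have "\<forall>i. \<forall>j. \<forall>k. cell_values v i j - cell_values v i k \<le> 3/5 * D"
    unfolding forall_type_3 using D
    by (simp add: cell_values_def sum_type_3 field_simps)
  then show ?thesis by (metis abs_le_iff minus_diff_eq)
qed

text \<open>Such a point lies in the \<open>m\<close>-fold image of the triangle under
  \<open>F j\<close>. That cell keeps the corner value \<open>v j\<close>, and its oscillation has
  shrunk by \<open>3/5\<close> in each step.\<close>

lemma harmonic_near_corner:
  assumes "x \<in> V_star" "\<And>j k. \<bar>v j - v k\<bar> \<le> D" "bary j x > 1 - (1/2) ^ m"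
  shows "\<bar>harmonic v x - v j\<bar> \<le> (3/5) ^ m * D"
  using assms
proof (induction m arbitrary: x v D)
  case 0
  have "v j - D \<le> v k \<and> v k \<le> v j + D" for k using 0(2)[of j k] by (simp add: abs_le_iff)
  then have "v j - D \<le> harmonic v x \<and> harmonic v x \<le> v j + D" by (rule harmonic_bounds[OF 0(1)])
  then show ?case by auto
next
  case (Suc m)
  obtain i y where y: "x = F i y" "y \<in> V_star" using V_star_cell[OF Suc.prems(1)] .
  \<comment> \<open>The strict bound beyond \<open>1/2\<close> excludes every cell other than
    \<open>F j\<close>, since \<open>bary j\<close> is at most \<open>1/2\<close> there.\<close>
  have "(1/2::real) ^ m \<le> 1" by (simp add: power_le_one)
  then have "bary j x > 1/2" using Suc.prems(3) by simp
  moreover have "bary j y \<le> 1" using y V_star_subset_triangle bary_le_1 by blast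
  ultimately have i: "i = j" using y by (auto simp: bary_F split: if_splits)
  then have "bary j y > 1 - (1/2) ^ m" using Suc.prems(3) y by (simp add: bary_F)
  then have "\<bar>harmonic (cell_values v i) y - cell_values v i j\<bar> \<le> (3/5) ^ m * (3/5 * D)"
    using cell_values_contract[of v D i] Suc.prems(2) by (intro Suc.IH[OF y(2)]) auto
  then show ?case using y i by (simp add: harmonic_F cell_values_same)
qed

section \<open>Modulus of continuity in barycentric coordinates\<close>

definition bary_close :: "real \<Rightarrow> real^2 \<Rightarrow> real^2 \<Rightarrow> bool" where
  "bary_close r x y \<longleftrightarrow> (\<forall>k. \<bar>bary k x - bary k y\<bar> < r)"

lemma bary_close_sym: "bary_close r x y \<longleftrightarrow> bary_close r y x"
  by (simp add: bary_close_def abs_minus_commute)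

lemma bary_close_F: "bary_close (r / 2) (F i x) (F i y) \<longleftrightarrow> bary_close r x y"
proof -
  have "\<bar>bary k (F i x) - bary k (F i y)\<bar> = \<bar>bary k x - bary k y\<bar> / 2" for k
    by (simp add: bary_F diff_divide_distrib[symmetric])
  then show ?thesis by (simp add: bary_close_def)
qed

text \<open>Close points in different cells must be near the common midpoint: \<open>bary j\<close>
  is at least \<open>1/2\<close> at \<open>F j y\<close>, and half of \<open>bary j x\<close> at
  \<open>F i x\<close>.\<close>

lemma bary_close_distinct_cells:
  assumes "y \<in> triangle" "bary_close (r / 2) (F i x) (F j y)" "i \<noteq> j"
  shows "bary j x > 1 - r"
proof -
  have "\<bar>bary j (F i x) - bary j (F j y)\<bar> < r / 2" using assms(2) by (simp add: bary_close_def)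
  then show ?thesis using assms(3) bary_nonneg[OF assms(1), of j] by (simp add: bary_F abs_less_iff field_simps)
qed

text \<open>Induction on the scale. Points in one cell are zoomed in together; points in two cells
  are compared through the common midpoint with \<open>harmonic_near_corner\<close> on each side,
  whence the factor \<open>2\<close>.\<close>

lemma harmonic_modulus:
  assumes "x \<in> V_star" "y \<in> V_star" "\<And>j k. \<bar>v j - v k\<bar> \<le> D" "bary_close ((1/2) ^ m) x y"
  shows "\<bar>harmonic v x - harmonic v y\<bar> \<le> 2 * (3/5) ^ m * D"
  using assms
proof (induction m arbitrary: x y v D)
  case 0
  have "\<bar>harmonic v z - v 0\<bar> \<le> D" if "z \<in> V_star" for z
  proof -
    have "v 0 - D \<le> v k \<and> v k \<le> v 0 + D" for k using 0(3)[of 0 k] by (simp add: abs_le_iff)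
    then have "v 0 - D \<le> harmonic v z \<and> harmonic v z \<le> v 0 + D" by (rule harmonic_bounds[OF that])
    then show ?thesis by auto
  qed
  from this[OF 0(1)] this[OF 0(2)] show ?case by simp
next
  case (Suc m)
  obtain i x' where x: "x = F i x'" "x' \<in> V_star" using V_star_cell[OF Suc.prems(1)] .
  obtain j y' where y: "y = F j y'" "y' \<in> V_star" using V_star_cell[OF Suc.prems(2)] .
  have cl: "bary_close ((1/2) ^ m / 2) (F i x') (F j y')" using Suc.prems(4) x y by simp
  have contract: "\<bar>cell_values v i j - cell_values v i k\<bar> \<le> 3/5 * D" for i j k
    by (rule cell_values_contract) (rule Suc.prems(3))
  show ?case
  proof (cases "i = j")
    case True
    then have "bary_close ((1/2) ^ m) x' y'" using cl bary_close_F by simp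
    then have "\<bar>harmonic (cell_values v i) x' - harmonic (cell_values v i) y'\<bar> \<le> 2 * (3/5) ^ m * (3/5 * D)"
      by (rule Suc.IH[OF x(2) y(2) contract])
    then show ?thesis using x y True by (simp add: harmonic_F)
  next
    case False
    have "bary j x' > 1 - (1/2) ^ m"
      using bary_close_distinct_cells[OF _ cl False] y V_star_subset_triangle by blast
    then have 1: "\<bar>harmonic (cell_values v i) x' - cell_values v i j\<bar> \<le> (3/5) ^ m * (3/5 * D)"
      by (rule harmonic_near_corner[OF x(2) contract])
    have "bary i y' > 1 - (1/2) ^ m"
      using bary_close_distinct_cells[OF _ _ False[symmetric]] cl bary_close_sym x V_star_subset_triangle by blast
    then have 2: "\<bar>harmonic (cell_values v j) y' - cell_values v j i\<bar> \<le> (3/5) ^ m * (3/5 * D)"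
      by (rule harmonic_near_corner[OF y(2) contract])
    have "\<bar>harmonic (cell_values v i) x' - harmonic (cell_values v j) y'\<bar> \<le> 2 * ((3/5) ^ m * (3/5 * D))"
      using 1 2 cell_values_commute[of v i j] by linarith
    then show ?thesis using x y by (simp add: harmonic_F)
  qed
qed

definition bary_uniformly_continuous :: "(real^2 \<Rightarrow> real) \<Rightarrow> bool" where
  "bary_uniformly_continuous u \<longleftrightarrow>
     (\<forall>e>0. \<exists>r>0. \<forall>x\<in>V_star. \<forall>y\<in>V_star. bary_close r x y \<longrightarrow> \<bar>u x - u y\<bar> < e)"

lemma harmonic_uniformly_continuous: "bary_uniformly_continuous (harmonic v)"
  unfolding bary_uniformly_continuous_def
proof (intro allI impI)
  fix e :: real assume e: "e > 0"
  \<comment> \<open>The factor \<open>2\<close> lets each of the two absolute values be bounded by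
    \<open>D / 2\<close>, with no case distinction on \<open>j = k\<close>.\<close>
  define D where "D = (\<Sum>i\<in>UNIV. 2 * \<bar>v i\<bar>)"
  have D: "\<bar>v j - v k\<bar> \<le> D" for j k
    using member_le_sum[of j UNIV "\<lambda>i. 2 * \<bar>v i\<bar>"] member_le_sum[of k UNIV "\<lambda>i. 2 * \<bar>v i\<bar>"]
    by (simp add: D_def)
  have "D \<ge> 0" unfolding D_def by (intro sum_nonneg) simp
  \<comment> \<open>The summand \<open>1\<close> in the denominator covers \<open>D = 0\<close>, the
    case of constant corner values.\<close>
  then obtain m where "(3/5) ^ m < e / (2 * D + 1)"
    using real_arch_pow_inv[of "e / (2 * D + 1)" "3/5"] e by auto
  then have "2 * (3/5) ^ m * D + (3/5) ^ m < e" using \<open>D \<ge> 0\<close> by (simp add: field_simps)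
  moreover have "(3/5::real) ^ m > 0" by simp
  ultimately have m: "2 * (3/5) ^ m * D < e" by linarith
  show "\<exists>r>0. \<forall>x\<in>V_star. \<forall>y\<in>V_star. bary_close r x y \<longrightarrow> \<bar>harmonic v x - harmonic v y\<bar> < e"
  proof (intro exI conjI ballI impI)
    fix x y assume "x \<in> V_star" "y \<in> V_star" "bary_close ((1/2) ^ m) x y"
    then have "\<bar>harmonic v x - harmonic v y\<bar> \<le> 2 * (3/5) ^ m * D" using D by (intro harmonic_modulus) auto
    then show "\<bar>harmonic v x - harmonic v y\<bar> < e" using m by simp
  qed simp
qed

section \<open>Splines that are harmonic in each cell\<close>

lemma bary_close_corner: assumes "x \<in> triangle" "bary j x > 1 - r" shows "bary_close r x (q j)"
  unfolding bary_close_def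
proof
  fix k
  have "bary k x < r" if "k \<noteq> j"
    using bary_add_le_1[OF assms(1), of j k] assms(2) that by simp
  then show "\<bar>bary k x - bary k (q j)\<bar> < r"
    using assms bary_nonneg[OF assms(1), of k] bary_le_1[OF assms(1), of k] by (auto simp: bary_q)
qed

text \<open>Interpolates \<open>f\<close> on \<open>V n\<close>, harmonically within each cell of level \<open>n\<close>.\<close>

primrec spline :: "nat \<Rightarrow> (real^2 \<Rightarrow> real) \<Rightarrow> real^2 \<Rightarrow> real" where
  "spline 0 f = harmonic (f \<circ> q)"
| "spline (Suc n) f = glue (\<lambda>i. spline n (f \<circ> F i))"

lemma spline_eq: "x \<in> V n \<Longrightarrow> spline n f x = f x"
proof (induction n arbitrary: f x)
  case 0
  then show ?case by (auto simp: harmonic_q)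
next
  case (Suc n)
  then obtain i y where y: "y \<in> V n" "x = F i y" by auto
  have "y \<in> triangle" using y vertices_subset_triangle by blast
  then show ?case using y Suc.IH F_q_commute by (simp add: glue_F q_in_vertices)
qed

lemma spline_F: "x \<in> V_star \<Longrightarrow> spline (Suc n) f (F i x) = spline n (f \<circ> F i) x"
  using V_star_subset_triangle F_q_commute by (auto simp: glue_F q_in_vertices spline_eq)

text \<open>As for \<open>harmonic_modulus\<close>: one cell is handled by the induction hypothesis,
  two cells through their common midpoint at a cost of \<open>e / 2\<close> on each side. The radius
  \<open>s / 2\<close> reflects that \<open>F i\<close> halves coordinate differences.\<close>

lemma spline_uniformly_continuous: "bary_uniformly_continuous (spline n f)"
proof (induction n arbitrary: f)
  case 0
  then show ?case by (simp add: harmonic_uniformly_continuous)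
next
  case (Suc n)
  show ?case unfolding bary_uniformly_continuous_def
  proof (intro allI impI)
    fix e :: real assume "e > 0"
    then have "e / 2 > 0" by simp
    then have "\<forall>i. \<exists>r>0. \<forall>x\<in>V_star. \<forall>y\<in>V_star. bary_close r x y \<longrightarrow> \<bar>spline n (f \<circ> F i) x - spline n (f \<circ> F i) y\<bar> < e / 2"
      using Suc.IH unfolding bary_uniformly_continuous_def by blast
    then obtain r where r: "\<And>i. r i > 0"
      "\<And>i x y. \<lbrakk>x \<in> V_star; y \<in> V_star; bary_close (r i) x y\<rbrakk> \<Longrightarrow> \<bar>spline n (f \<circ> F i) x - spline n (f \<circ> F i) y\<bar> < e / 2"
      by metis
    define s where "s = Min (range r)"
    have s: "s > 0" "\<And>i. s \<le> r i" using r(1) by (auto simp: s_def)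
    have IH: "\<bar>spline n (f \<circ> F i) x - spline n (f \<circ> F i) y\<bar> < e / 2"
      if "x \<in> V_star" "y \<in> V_star" "bary_close s x y" for i x y
    proof (rule r(2)[OF that(1,2)])
      show "bary_close (r i) x y"
        using that(3) s(2)[of i] unfolding bary_close_def by (meson order.strict_trans2)
    qed
    have "\<bar>spline (Suc n) f x - spline (Suc n) f y\<bar> < e"
      if xy: "x \<in> V_star" "y \<in> V_star" "bary_close (s / 2) x y" for x y
    proof -
      obtain i x' where x: "x = F i x'" "x' \<in> V_star" using V_star_cell[OF xy(1)] .
      obtain j y' where y: "y = F j y'" "y' \<in> V_star" using V_star_cell[OF xy(2)] .
      note T = x(2)[THEN subsetD[OF V_star_subset_triangle]] y(2)[THEN subsetD[OF V_star_subset_triangle]]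
      have val: "spline (Suc n) f x = spline n (f \<circ> F i) x'" "spline (Suc n) f y = spline n (f \<circ> F j) y'"
        using x y spline_F by auto
      show ?thesis
      proof (cases "i = j")
        case True
        then show ?thesis using IH[OF x(2) y(2), of i] xy(3) x y bary_close_F val \<open>e > 0\<close> by fastforce
      next
        case False
        have "bary_close s x' (q j)"
          using bary_close_corner[OF T(1)] bary_close_distinct_cells[OF T(2) _ False] xy(3) x y by blast
        then have 1: "\<bar>spline n (f \<circ> F i) x' - spline n (f \<circ> F i) (q j)\<bar> < e / 2"
          by (rule IH[OF x(2) q_in_V_star])
        have "bary_close s y' (q i)"
          using bary_close_corner[OF T(2)] bary_close_distinct_cells[OF T(1) _ False[symmetric]] xy(3) x y
            bary_close_sym by blast
        then have 2: "\<bar>spline n (f \<circ> F j) y' - spline n (f \<circ> F j) (q i)\<bar> < e / 2"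
          by (rule IH[OF y(2) q_in_V_star])
        have "spline n (f \<circ> F i) (q j) = spline n (f \<circ> F j) (q i)"
          using F_q_commute by (simp add: spline_eq q_in_vertices)
        with 1 2 show ?thesis unfolding val by linarith
      qed
    qed
    then show "\<exists>r>0. \<forall>x\<in>V_star. \<forall>y\<in>V_star. bary_close r x y \<longrightarrow> \<bar>spline (Suc n) f x - spline (Suc n) f y\<bar> < e"
      using s(1) by (intro exI[of _ "s / 2"]) auto
  qed
qed

section \<open>Continuous extension without change of energy\<close>

lemma vertices_subset_V_star: "V n \<subseteq> V_star"
  by (auto simp: V_star_def)

lemma energy_harmonic: "energy m (harmonic v) = corner_energy v"
proof (induction m arbitrary: v)
  case 0
  have "harmonic v \<circ> q = v" by (simp add: fun_eq_iff harmonic_q)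
  then show ?case by (simp add: energy_0)
next
  case (Suc m)
  have "energy m (harmonic v \<circ> F i) = energy m (harmonic (cell_values v i))" for i
    by (rule energy_cong) (simp add: harmonic_F vertices_subset_V_star[THEN subsetD])
  then show ?case using corner_energy_cell_values[of v] by (simp add: energy_Suc Suc.IH)
qed

lemma energy_spline: "energy (n + m) (spline n f) = energy n f"
proof (induction n arbitrary: f)
  case 0
  then show ?case by (simp add: energy_harmonic energy_0)
next
  case (Suc n)
  have "energy (n + m) (spline (Suc n) f \<circ> F i) = energy (n + m) (spline n (f \<circ> F i))" for i
    by (rule energy_cong) (simp add: spline_F vertices_subset_V_star[THEN subsetD] del: spline.simps)
  then show ?case by (simp only: add_Suc energy_Suc Suc.IH)
qed

text \<open>The Lipschitz bound on the coordinates turns coordinate closeness into metric closeness.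
  Uniform continuity then gives an extension to the closure of \<open>V_star\<close>, and Tietze's
  theorem one to the plane.\<close>

lemma continuous_extension:
  assumes "bary_uniformly_continuous u"
  obtains g where "continuous_on UNIV g" "\<And>x. x \<in> V_star \<Longrightarrow> g x = u x"
proof -
  obtain L where L: "L > 0" "\<And>j x y. \<bar>bary j x - bary j y\<bar> \<le> L * dist x y"
    using bary_lipschitz by blast
  have "uniformly_continuous_on V_star u"
    unfolding uniformly_continuous_on_def
  proof (intro allI impI)
    fix e :: real assume "e > 0"
    then obtain r where r: "r > 0" "\<And>x y. \<lbrakk>x \<in> V_star; y \<in> V_star; bary_close r x y\<rbrakk> \<Longrightarrow> \<bar>u x - u y\<bar> < e"
      using assms unfolding bary_uniformly_continuous_def by blast
    have "bary_close r x y" if "dist y x < r / L" for x y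
    proof -
      have "L * dist x y < r" using that L(1) by (simp add: field_simps dist_commute)
      then show ?thesis unfolding bary_close_def using L(2) order.strict_trans1 by blast
    qed
    then show "\<exists>d>0. \<forall>x\<in>V_star. \<forall>x'\<in>V_star. dist x' x < d \<longrightarrow> dist (u x') (u x) < e"
      using r L(1) by (intro exI[of _ "r / L"]) (auto simp: dist_real_def bary_close_sym)
  qed
  then obtain h where h: "uniformly_continuous_on (closure V_star) h" "\<And>x. x \<in> V_star \<Longrightarrow> u x = h x"
    using uniformly_continuous_on_extension_on_closure by metis
  obtain g where "continuous_on UNIV g" "\<And>x. x \<in> closure V_star \<Longrightarrow> g x = h x"
    using Tietze_unbounded[OF uniformly_continuous_imp_continuous[OF h(1)], of UNIV] by auto
  then show ?thesis using that h(2) closure_subset by (metis subsetD)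
qed

text \<open>Together with \<open>energy_le_sg_energy\<close> this shows that
  \<open>energy n f\<close> is the least energy for the values of \<open>f\<close> on
  \<open>V n\<close>, so the minimization reduces to a finite network.\<close>

lemma energy_extension:
  obtains u where "u \<in> sg_dom_energy q" "\<And>x. x \<in> V n \<Longrightarrow> u x = f x" "sg_energy q u = ereal (energy n f)"
proof -
  obtain g where g: "continuous_on UNIV g" "\<And>x. x \<in> V_star \<Longrightarrow> g x = spline n f x"
    using continuous_extension[OF spline_uniformly_continuous] by blast
  have "energy m g = energy n f" if "m \<ge> n" for m
  proof -
    have "energy m g = energy m (spline n f)"
      using g(2) vertices_subset_V_star by (intro energy_cong) auto
    then show ?thesis using energy_spline[of n "m - n"] that by simp
  qed
  then have e: "sg_energy q g = ereal (energy n f)" by (rule sg_energy_eqI)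
  moreover have "g \<in> sg_dom_energy q"
    using e g(1) continuous_on_subset by (auto simp: sg_dom_energy_def)
  moreover have "g x = f x" if "x \<in> V n" for x
    using that g(2) vertices_subset_V_star[THEN subsetD] by (simp add: spline_eq)
  ultimately show ?thesis using that by blast
qed

section \<open>Conductances of the new vertices\<close>

text \<open>At level one the cell \<open>F i\<close> has the single old vertex \<open>q i\<close>.
  The general case follows by pulling both ends back into their common cell.\<close>

lemma old_vertices_independent: "sg_adj q (Suc n) x y \<Longrightarrow> x \<in> V n \<Longrightarrow> y \<notin> V n"
proof (induction n arbitrary: x y)
  case 0
  then obtain i x' y' where *: "x = F i x'" "y = F i y'" "sg_adj q 0 x' y'" by (auto simp: adj_Suc)
  then obtain j k where jk: "x' = q j" "y' = q k" "j \<noteq> k" by (auto simp: adj_0)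
  have "l = i" if old: "F i (q l) \<in> V 0" for l
  proof -
    obtain m where "F i (q l) = q m" using old by auto
    then have m: "F i (q l) = F m (q m)" by (simp only: F_q)
    show ?thesis
    proof (cases "i = m")
      case True
      then show ?thesis using m inj_q by (simp add: F_inject inj_eq)
    next
      case False
      then have "q l = q m" using F_eq_F_corner[OF q_in_triangle q_in_triangle m] by simp
      moreover have "q m = q i" using F_eq_F_corner[OF q_in_triangle q_in_triangle m[symmetric]] False by simp
      ultimately show ?thesis using inj_q by (simp add: inj_eq)
    qed
  qed
  then show ?case using 0(2) * jk by blast
next
  case (Suc n)
  obtain i x' y' where *: "x = F i x'" "y = F i y'" "sg_adj q (Suc n) x' y'"
    using Suc.prems(1) unfolding adj_Suc[of "Suc n"] by blast
  then show ?case
    using Suc.IH[OF *(3)] Suc.prems(2)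
    by (simp add: F_in_vertices_Suc_iff adj_in_triangle[OF *(3)] del: sg_vertices.simps)
qed

section \<open>Minimal energy for given values on the new vertices\<close>

definition new_vertices :: "nat \<Rightarrow> (real^2) set" where "new_vertices k = V (Suc k) - V k"

text \<open>The index is the coarser level: \<open>conductance k\<close> belongs to the set of
  vertices of level \<open>Suc k\<close> that are not of level \<open>k\<close>.\<close>

definition conductance :: "nat \<Rightarrow> real^2 \<Rightarrow> real^2 \<Rightarrow> real" where
  "conductance k x y =
     (if x \<in> new_vertices k \<and> y \<in> new_vertices k \<and> x \<noteq> y
      then (5/3) ^ Suc k * mesh_conductance (sg_adj q (Suc k)) (new_vertices k) (V k) x y else 0)"

definition conductance_form :: "nat \<Rightarrow> (real^2 \<Rightarrow> real) \<Rightarrow> real" where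
  "conductance_form k u = (\<Sum>x\<in>new_vertices k. \<Sum>y\<in>new_vertices k. conductance k x y * (u x - u y)\<^sup>2) / 2"

definition nbr_mean :: "nat \<Rightarrow> (real^2 \<Rightarrow> real) \<Rightarrow> real^2 \<Rightarrow> real" where
  "nbr_mean k u z = (\<Sum>a | a \<in> new_vertices k \<and> sg_adj q (Suc k) z a. u a) / card {a \<in> new_vertices k. sg_adj q (Suc k) z a}"

lemma energy_star_mesh:
  "energy (Suc k) u = conductance_form k u +
     (5/3) ^ Suc k * (\<Sum>z\<in>V k. card {a \<in> new_vertices k. sg_adj q (Suc k) z a} * (u z - nbr_mean k u z)\<^sup>2)"
proof -
  have "conductance_form k u = (5/3) ^ Suc k *
      ((\<Sum>x\<in>new_vertices k. \<Sum>y\<in>new_vertices k. mesh_conductance (sg_adj q (Suc k)) (new_vertices k) (V k) x y * (u x - u y)\<^sup>2) / 2)"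
    unfolding conductance_form_def times_divide_eq_right sum_distrib_left
    by (intro arg_cong2[where f="(/)"] sum.cong refl) (auto simp: conductance_def)
  moreover have "(\<Sum>(x, y)\<in>{(x, y). sg_adj q (Suc k) x y}. (u x - u y)\<^sup>2) / 2 =
    (\<Sum>x\<in>new_vertices k. \<Sum>y\<in>new_vertices k. mesh_conductance (sg_adj q (Suc k)) (new_vertices k) (V k) x y * (u x - u y)\<^sup>2) / 2 +
    (\<Sum>z\<in>V k. card {a\<in>new_vertices k. sg_adj q (Suc k) z a} * (u z - nbr_mean k u z)\<^sup>2)"
    unfolding nbr_mean_def
  proof (rule star_mesh)
    show "finite (new_vertices k)" "finite (V k)" using finite_vertices by (auto simp: new_vertices_def simp del: sg_vertices.simps)
    show "new_vertices k \<inter> V k = {}" by (auto simp: new_vertices_def)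
    show "sg_adj q (Suc k) x y \<longleftrightarrow> sg_adj q (Suc k) y x" for x y by (rule adj_sym)
    show "sg_adj q (Suc k) x y \<Longrightarrow> x \<in> new_vertices k \<union> V k" for x y
      using adj_in_vertices by (auto simp: new_vertices_def simp del: sg_vertices.simps)
    show "x \<in> V k \<Longrightarrow> y \<in> V k \<Longrightarrow> \<not> sg_adj q (Suc k) x y" for x y
      using old_vertices_independent by blast
  qed
  ultimately show ?thesis by (simp add: sg_graph_energy_def distrib_left)
qed

lemma conductance_form_le_energy: "conductance_form k u \<le> energy (Suc k) u"
  unfolding energy_star_mesh by (simp add: sum_nonneg)

lemma conductance_form_cong:
  "(\<And>x. x \<in> new_vertices k \<Longrightarrow> u x = v x) \<Longrightarrow> conductance_form k u = conductance_form k v"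
  by (simp add: conductance_form_def)

text \<open>Neighbor means at the old vertices make the remainder in \<open>energy_star_mesh\<close>
  vanish; \<open>energy_extension\<close> then carries the result to the gasket.\<close>

lemma minimal_extension:
  obtains u where "u \<in> sg_dom_energy q" "\<And>x. x \<in> new_vertices k \<Longrightarrow> u x = f x"
    "sg_energy q u = ereal (conductance_form k f)"
proof -
  define g where "g x = (if x \<in> new_vertices k then f x else nbr_mean k f x)" for x
  obtain u where u: "u \<in> sg_dom_energy q" "\<And>x. x \<in> V (Suc k) \<Longrightarrow> u x = g x" "sg_energy q u = ereal (energy (Suc k) g)"
    using energy_extension by blast
  \<comment> \<open>The means involve new vertices only, so overwriting \<open>f\<close> at old
    vertices leaves them unchanged.\<close>
  have "nbr_mean k g z = nbr_mean k f z" for z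
    unfolding nbr_mean_def by (intro arg_cong2[where f="(/)"] sum.cong refl) (auto simp: g_def)
  then have "energy (Suc k) g = conductance_form k g"
    unfolding energy_star_mesh by (simp add: g_def new_vertices_def)
  also have "\<dots> = conductance_form k f" by (rule conductance_form_cong) (simp add: g_def)
  finally have "sg_energy q u = ereal (conductance_form k f)" using u(3) by simp
  moreover have "u x = f x" if "x \<in> new_vertices k" for x
    using that u(2)[of x] by (simp add: g_def new_vertices_def)
  ultimately show ?thesis using that u(1) by blast
qed

lemma energy_ge_conductance_form: "ereal (conductance_form k u) \<le> sg_energy q u"
  using conductance_form_le_energy energy_le_sg_energy by (meson ereal_less_eq(3) order_trans)

lemma minimizer_energy:
  assumes "sg_energy_minimizer q (new_vertices k) u"
  shows "sg_energy q u = ereal (conductance_form k u)"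
proof (rule antisym)
  obtain v where "v \<in> sg_dom_energy q" "\<And>x. x \<in> new_vertices k \<Longrightarrow> v x = u x"
    "sg_energy q v = ereal (conductance_form k u)"
    using minimal_extension by blast
  then show "sg_energy q u \<le> ereal (conductance_form k u)"
    using assms unfolding sg_energy_minimizer_def by metis
qed (rule energy_ge_conductance_form)

text \<open>Every choice of values occurs for a minimizer, so the condition on minimizers in
  \<open>sg_conductance\<close> tests the quadratic form at all \<open>f\<close>.\<close>

lemma minimizer_exists:
  obtains u where "sg_energy_minimizer q (new_vertices k) u" "\<And>x. x \<in> new_vertices k \<Longrightarrow> u x = f x"
proof -
  obtain u where u: "u \<in> sg_dom_energy q" "\<And>x. x \<in> new_vertices k \<Longrightarrow> u x = f x"
    "sg_energy q u = ereal (conductance_form k f)"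
    using minimal_extension by blast
  have "sg_energy q u \<le> sg_energy q v" if "\<forall>x\<in>new_vertices k. v x = u x" for v
    using energy_ge_conductance_form[of k v] conductance_form_cong[of k v f] that u(2,3) by simp
  then show ?thesis using that u unfolding sg_energy_minimizer_def by blast
qed

text \<open>Existence is \<open>minimizer_energy\<close>. For uniqueness, any candidate has the same
  quadratic form by \<open>minimizer_exists\<close>, and the form determines the off-diagonal
  coefficients.\<close>

lemma sg_conductance_eq: "sg_conductance q (new_vertices k) = conductance k"
  unfolding sg_conductance_def
proof (rule the_equality)
  let ?A = "new_vertices k"
  have sym: "conductance k x y = conductance k y x" for x y
    using mesh_conductance_commute[of "sg_adj q (Suc k)", OF adj_sym] by (auto simp: conductance_def)
  then show "(\<forall>x y. conductance k x y = conductance k y x) \<and>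
    (\<forall>x y. \<not> (x \<in> ?A \<and> y \<in> ?A \<and> x \<noteq> y) \<longrightarrow> conductance k x y = 0) \<and>
    (\<forall>u. sg_energy_minimizer q ?A u \<longrightarrow>
      sg_energy q u = ereal ((\<Sum>x\<in>?A. \<Sum>y\<in>?A. conductance k x y * (u x - u y)\<^sup>2) / 2))"
    using minimizer_energy unfolding conductance_form_def by (auto simp: conductance_def)
  fix c
  assume c: "(\<forall>x y. c x y = c y x) \<and> (\<forall>x y. \<not> (x \<in> ?A \<and> y \<in> ?A \<and> x \<noteq> y) \<longrightarrow> c x y = 0) \<and>
    (\<forall>u. sg_energy_minimizer q ?A u \<longrightarrow>
      sg_energy q u = ereal ((\<Sum>x\<in>?A. \<Sum>y\<in>?A. c x y * (u x - u y)\<^sup>2) / 2))"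
  have eq: "(\<Sum>x\<in>?A. \<Sum>y\<in>?A. c x y * (f x - f y)\<^sup>2) = (\<Sum>x\<in>?A. \<Sum>y\<in>?A. conductance k x y * (f x - f y)\<^sup>2)" for f
  proof -
    obtain u where u: "sg_energy_minimizer q ?A u" "\<And>x. x \<in> ?A \<Longrightarrow> u x = f x"
      using minimizer_exists by blast
    have "(\<Sum>x\<in>?A. \<Sum>y\<in>?A. c x y * (u x - u y)\<^sup>2) = (\<Sum>x\<in>?A. \<Sum>y\<in>?A. conductance k x y * (u x - u y)\<^sup>2)"
      using c u(1) minimizer_energy[OF u(1)] unfolding conductance_form_def by auto
    then show ?thesis using u(2) by simp
  qed
  have fin: "finite ?A" using finite_vertices by (simp add: new_vertices_def del: sg_vertices.simps)
  show "c = conductance k"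
  proof (intro ext)
    fix x y
    show "c x y = conductance k x y"
    proof (cases "x \<in> ?A \<and> y \<in> ?A \<and> x \<noteq> y")
      case True
      then show ?thesis
        using quadratic_form_determines_conductances[of ?A c "conductance k" x y, OF fin _ sym eq] c by blast
    next
      case False
      then show ?thesis using c by (auto simp: conductance_def)
    qed
  qed
qed

section \<open>Neighbors of corners and of first-level midpoints\<close>

definition nbrs :: "nat \<Rightarrow> real^2 \<Rightarrow> (real^2) set" where
  "nbrs n x = {y. sg_adj q n x y}"

text \<open>The corner \<open>q j\<close> lies in the cell \<open>F j\<close> only, as its fixed
  point.\<close>

lemma nbrs_q_Suc: "nbrs (Suc n) (q j) = F j ` nbrs n (q j)"
proof -
  have "i = j \<and> x = q j" if "q j = F i x" "x \<in> triangle" for i x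
  proof -
    have e: "F j (q j) = F i x" unfolding F_q by (rule that(1))
    then have "i = j" using F_eq_F_corner[OF q_in_triangle that(2) e] inj_q by (auto simp: inj_eq)
    then show ?thesis using e by (simp add: F_inject)
  qed
  then have "sg_adj q (Suc n) (q j) y \<longleftrightarrow> (\<exists>y'. y = F j y' \<and> sg_adj q n (q j) y')" for y
    unfolding adj_Suc by (metis F_q adj_in_triangle(1))
  then show ?thesis by (auto simp: nbrs_def)
qed

lemma nbrs_not_old: "\<lbrakk>y \<in> nbrs (Suc n) x; x \<in> V n\<rbrakk> \<Longrightarrow> y \<notin> V n"
  using old_vertices_independent by (simp add: nbrs_def)

lemma card_nbrs_q: "card (nbrs n (q j)) = 2"
proof (induction n)
  case 0
  have "nbrs 0 (q j) = range q - {q j}" by (auto simp: nbrs_def adj_0)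
  moreover have "card (range q) = 3" using inj_q by (simp add: card_image)
  ultimately show ?case by simp
next
  case (Suc n)
  then show ?case by (simp add: nbrs_q_Suc card_image inj_F)
qed

text \<open>The image under \<open>F j\<close> of a point other than a corner lies in no other cell,
  so all edges at it stay inside \<open>F j\<close>.\<close>

lemma adj_within_cell:
  assumes "sg_adj q (Suc n) z (F j a)" "a \<in> triangle" "a \<notin> range q"
  obtains z' where "z = F j z'" "sg_adj q n z' a"
proof -
  obtain i z' a' where *: "z = F i z'" "F j a = F i a'" "sg_adj q n z' a'"
    using assms(1) unfolding adj_Suc by blast
  have "i = j" using F_eq_F_corner[OF assms(2) adj_in_triangle(2)[OF *(3)] *(2)] assms(3) by blast
  then show ?thesis using * that by (simp add: F_inject)
qed

text \<open>From level one on, neighbors of a corner are new vertices and hence no corners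
  themselves, so \<open>adj_within_cell\<close> pulls \<open>z\<close> back.\<close>

lemma nbr_of_corner_nbr:
  assumes "a \<in> nbrs (Suc n) (q k)" "sg_adj q (Suc (Suc n)) z (F j a)" "z \<in> V (Suc n)"
  obtains z' where "z = F j z'" "sg_adj q (Suc n) z' a" "z' \<in> V n"
proof -
  have "a \<in> triangle" using assms(1) adj_in_triangle by (auto simp: nbrs_def)
  moreover have "a \<notin> range q"
    using nbrs_not_old[OF assms(1) q_in_vertices] q_in_vertices by auto
  ultimately obtain z' where z: "z = F j z'" "sg_adj q (Suc n) z' a" using adj_within_cell assms(2) by blast
  then show ?thesis
    using that assms(3) F_in_vertices_Suc_iff[OF adj_in_triangle(1)[OF z(2)]] by blast
qed

text \<open>Induction by zooming into the cell \<open>F j\<close>. At the lowest level, a common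
  neighbor \<open>q t\<close> with \<open>t\<close> other than \<open>j\<close> would force both
  \<open>a\<close> and \<open>b\<close> to be the midpoint \<open>F j (q t)\<close>.\<close>

lemma common_nbr_of_corner_nbrs:
  "\<lbrakk>a \<in> nbrs (Suc n) (q j); b \<in> nbrs (Suc n) (q j); a \<noteq> b; z \<in> V n;
    sg_adj q (Suc n) z a; sg_adj q (Suc n) z b\<rbrakk> \<Longrightarrow> z = q j"
proof (induction n arbitrary: a b z)
  case 0
  obtain t where t: "z = q t" using 0 by auto
  have corner_nbr: "\<exists>k. y = F l (q k)" if "y \<in> nbrs (Suc 0) (q l)" for y l
    using that unfolding nbrs_q_Suc by (auto simp: nbrs_def adj_0)
  have *: "\<exists>k. y = F j (q k) \<and> (t \<noteq> j \<longrightarrow> k = t)" if y: "y \<in> nbrs (Suc 0) (q j)" "sg_adj q (Suc 0) z y" for y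
  proof -
    obtain k where k: "y = F j (q k)" using y(1) corner_nbr by blast
    have "y \<in> nbrs (Suc 0) (q t)" using y(2) t by (simp add: nbrs_def)
    then obtain s where s: "y = F t (q s)" using corner_nbr by blast
    have "q k = q t" if "t \<noteq> j" using F_eq_F_corner[OF q_in_triangle q_in_triangle] k s that by metis
    then show ?thesis using k inj_q by (auto simp: inj_eq)
  qed
  show ?case using *[OF 0(1,5)] *[OF 0(2,6)] 0(3) t by auto
next
  case (Suc n)
  obtain a' b' where ab: "a = F j a'" "a' \<in> nbrs (Suc n) (q j)" "b = F j b'" "b' \<in> nbrs (Suc n) (q j)"
    using Suc.prems(1,2) nbrs_q_Suc by auto
  obtain z' where z: "z = F j z'" "sg_adj q (Suc n) z' a'" "z' \<in> V n"
    using nbr_of_corner_nbr[OF ab(2)] Suc.prems ab by metis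
  obtain z'' where z': "z = F j z''" "sg_adj q (Suc n) z'' b'"
    using nbr_of_corner_nbr[OF ab(4)] Suc.prems ab by metis
  have "z'' = z'" using z z' F_inject by simp
  then have "z' = q j" using Suc.IH[OF ab(2,4) _ z(3,2)] z'(2) Suc.prems(3) ab by blast
  then show ?case using z F_q by simp
qed

text \<open>The midpoint lies in exactly the two cells \<open>F j\<close> and \<open>F k\<close>, as
  the image of a corner in each.\<close>

lemma nbrs_midpoint:
  assumes "j \<noteq> k" shows "nbrs (Suc n) (F j (q k)) = F j ` nbrs n (q k) \<union> F k ` nbrs n (q j)"
proof -
  have "(i = j \<and> x = q k) \<or> (i = k \<and> x = q j)" if "F j (q k) = F i x" "x \<in> triangle" for i x
  proof (cases "i = j")
    case True
    then show ?thesis using that(1) by (simp add: F_inject)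
  next
    case False
    then have "i = k" using F_eq_F_corner[OF q_in_triangle that(2,1)] inj_q by (auto simp: inj_eq)
    then show ?thesis using that(1) F_q_commute[of j k] by (simp add: F_inject)
  qed
  then have "sg_adj q (Suc n) (F j (q k)) y \<longleftrightarrow>
      (\<exists>y'. y = F j y' \<and> sg_adj q n (q k) y' \<or> y = F k y' \<and> sg_adj q n (q j) y')" for y
    unfolding adj_Suc by (metis F_q_commute adj_in_triangle(1))
  then show ?thesis by (auto simp: nbrs_def)
qed

text \<open>Each cell contributes two neighbors. None is counted twice, since the cells share only
  the midpoint, which is not adjacent to itself.\<close>

lemma card_nbrs_midpoint:
  assumes "j \<noteq> k" shows "card (nbrs (Suc n) (F j (q k))) = 4"
proof -
  have fin: "finite (nbrs n x)" for x
    by (rule finite_subset[OF _ finite_vertices[of n]]) (auto simp: nbrs_def dest: adj_in_vertices)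
  have "F j ` nbrs n (q k) \<inter> F k ` nbrs n (q j) = {}"
  proof (rule ccontr)
    assume "\<not> ?thesis"
    then obtain a b where "sg_adj q n (q k) a" "sg_adj q n (q j) b" "F j a = F k b" by (auto simp: nbrs_def)
    then show False using F_eq_F_corner[OF _ _ _ assms] adj_in_triangle adj_irrefl by metis
  qed
  then show ?thesis
    using assms fin by (simp add: nbrs_midpoint card_Un_disjoint card_image inj_F card_nbrs_q)
qed

text \<open>If \<open>a\<close> and \<open>b\<close> lie in one cell,
  \<open>common_nbr_of_corner_nbrs\<close> applies inside it. Otherwise \<open>z\<close> belongs to
  both cells and is their common point.\<close>

lemma common_nbr_of_midpoint_nbrs:
  assumes jk: "j \<noteq> k" and ab: "a \<in> nbrs (Suc (Suc n)) (F j (q k))" "b \<in> nbrs (Suc (Suc n)) (F j (q k))" "a \<noteq> b"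
    and z: "z \<in> V (Suc n)" "sg_adj q (Suc (Suc n)) z a" "sg_adj q (Suc (Suc n)) z b"
  shows "z = F j (q k)"
proof -
  \<comment> \<open>\<open>P i l\<close> treats the two cells symmetrically: in the cell
    \<open>F i\<close> the midpoint is the image of \<open>q l\<close>.\<close>
  define P where "P i x \<longleftrightarrow> (i = j \<and> x = k) \<or> (i = k \<and> x = j)" for i x
  have *: "\<exists>i l y z'. P i l \<and> x = F i y \<and> y \<in> nbrs (Suc n) (q l) \<and> z = F i z' \<and> sg_adj q (Suc n) z' y \<and> z' \<in> V n"
    if x: "x \<in> nbrs (Suc (Suc n)) (F j (q k))" "sg_adj q (Suc (Suc n)) z x" for x
  proof -
    obtain i l y where y: "P i l" "x = F i y" "y \<in> nbrs (Suc n) (q l)"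
      using x(1) unfolding nbrs_midpoint[OF jk] P_def by blast
    obtain z' where "z = F i z'" "sg_adj q (Suc n) z' y" "z' \<in> V n"
      using nbr_of_corner_nbr[OF y(3) x(2)[unfolded y(2)] z(1)] .
    then show ?thesis using y by blast
  qed
  obtain i l a' z1 where 1: "P i l" "a = F i a'" "a' \<in> nbrs (Suc n) (q l)" "z = F i z1" "sg_adj q (Suc n) z1 a'" "z1 \<in> V n"
    using *[OF ab(1) z(2)] by blast
  obtain i' l' b' z2 where 2: "P i' l'" "b = F i' b'" "b' \<in> nbrs (Suc n) (q l')" "z = F i' z2" "sg_adj q (Suc n) z2 b'" "z2 \<in> V n"
    using *[OF ab(2) z(3)] by blast
  have "z1 = q l"
  proof (cases "i = i'")
    case True
    then have "l' = l" "z2 = z1" "a' \<noteq> b'" using 1 2 jk ab(3) by (auto simp: P_def F_inject)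
    then show ?thesis using common_nbr_of_corner_nbrs[of a' n l b' z1] 1 2 by simp
  next
    case False
    then have "i' = l" using 1(1) 2(1) by (auto simp: P_def)
    then show ?thesis
      using F_eq_F_corner[of z1 z2 i i'] False 1 2 adj_in_triangle by metis
  qed
  then show ?thesis using 1 F_q_commute[of j k] by (auto simp: P_def)
qed

lemma conductance_midpoint_nbrs:
  assumes jk: "j \<noteq> k" and ab: "a \<in> nbrs (Suc (Suc n)) (F j (q k))" "b \<in> nbrs (Suc (Suc n)) (F j (q k))" "a \<noteq> b"
  shows "conductance (Suc n) a b = (5/3) ^ Suc (Suc n) * (of_bool (sg_adj q (Suc (Suc n)) a b) + 1/4)"
proof -
  let ?A = "new_vertices (Suc n)" and ?p = "F j (q k)" and ?adj = "sg_adj q (Suc (Suc n))"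
  have p: "?p \<in> V (Suc n)" using q_in_vertices[of k n] by auto
  have new: "x \<in> ?A" if "x \<in> nbrs (Suc (Suc n)) ?p" for x
    using that nbrs_not_old[OF that p] adj_in_vertices[of "Suc (Suc n)" ?p x]
    by (simp add: new_vertices_def nbrs_def del: sg_vertices.simps)
  then have "{x \<in> ?A. ?adj ?p x} = nbrs (Suc (Suc n)) ?p" by (auto simp: nbrs_def)
  then have deg: "card {x \<in> ?A. ?adj ?p x} = 4" using card_nbrs_midpoint[OF jk] by simp
  have "(\<Sum>z\<in>V (Suc n). of_bool (?adj z a \<and> ?adj z b) / card {x \<in> ?A. ?adj z x}) =
    (\<Sum>z\<in>{?p}. of_bool (?adj z a \<and> ?adj z b) / card {x \<in> ?A. ?adj z x} :: real)"
    using common_nbr_of_midpoint_nbrs[OF jk ab] p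
    by (intro sum.mono_neutral_right finite_vertices) auto
  also have "\<dots> = 1/4" using ab deg by (simp add: nbrs_def)
  finally show ?thesis using ab new by (simp add: conductance_def mesh_conductance_def)
qed

section \<open>Graph distance\<close>

lemma graph_dist_le: "(sg_adj q n ^^ k) x y \<Longrightarrow> sg_graph_dist q n x y \<le> enat k"
  unfolding sg_graph_dist_def by (rule INF_lower) simp

text \<open>A finite value excludes an empty set of path lengths, and a nonempty set of
  \<open>enat\<close> contains its infimum.\<close>

lemma graph_dist_attained:
  assumes "sg_graph_dist q n x y = enat k" shows "(sg_adj q n ^^ k) x y"
proof -
  let ?S = "enat ` {k. (sg_adj q n ^^ k) x y}"
  have "?S \<noteq> {}"
  proof
    assume "?S = {}"
    then have "sg_graph_dist q n x y = \<infinity>" unfolding sg_graph_dist_def by (simp only: Inf_empty top_enat_def)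
    then show False using assms by simp
  qed
  then have "Inf ?S \<in> ?S" unfolding Inf_enat_def by (auto intro: LeastI)
  then show ?thesis using assms unfolding sg_graph_dist_def by auto
qed

end

theorem lemma2p15:
  fixes q :: "3 \<Rightarrow> real^2" and n :: nat and i :: 3 and a b :: "real^2"
  assumes "equilateral q"
    and "n \<ge> 3"
    and "a \<in> sg_midpoint_nbrs q n i"
    and "b \<in> sg_midpoint_nbrs q n i"
  shows "(sg_graph_dist q n a b = 1 \<longrightarrow>
            sg_conductance q (sg_vertices q n - sg_vertices q (n - 1)) a b = (5/3) ^ n * (5/4))
       \<and> (sg_graph_dist q n a b = 2 \<longrightarrow>
            sg_conductance q (sg_vertices q n - sg_vertices q (n - 1)) a b = (5/3) ^ n * (1/4))"
proof -
  interpret equilateral_triangle q using assms(1) by unfold_locales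
  obtain m where n: "n = Suc (Suc m)" using assms(2) by (intro that[of "n - 2"]) simp
  \<comment> \<open>Modulo 3, equality would mean \<open>2 = 0\<close>.\<close>
  have jk: "i - 1 \<noteq> i + 1" using forall_type_3[of "\<lambda>i. i - 1 \<noteq> i + 1"] by simp
  have ab: "a \<in> nbrs (Suc (Suc m)) (F (i - 1) (q (i + 1)))" "b \<in> nbrs (Suc (Suc m)) (F (i - 1) (q (i + 1)))"
    using assms(3,4) by (simp_all add: sg_midpoint_nbrs_def nbrs_def n)
  have c: "sg_conductance q (V n - V (n - 1)) a b = (5/3) ^ n * (of_bool (sg_adj q n a b) + 1/4)" if "a \<noteq> b"
    using conductance_midpoint_nbrs[OF jk ab that] sg_conductance_eq[of "Suc m"]
    by (simp add: n new_vertices_def del: sg_vertices.simps)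
  show ?thesis
  proof (intro conjI impI)
    assume "sg_graph_dist q n a b = 1"
    then have "sg_adj q n a b" using graph_dist_attained[of n a b 1] by (simp add: one_enat_def eq_OO)
    moreover from this have "a \<noteq> b" using adj_irrefl by blast
    ultimately show "sg_conductance q (V n - V (n - 1)) a b = (5/3) ^ n * (5/4)" using c by simp
  next
    assume d: "sg_graph_dist q n a b = 2"
    \<comment> \<open>A path of length \<open>0\<close> would make the distance at most
      \<open>0\<close>; in the same way an edge would make it at most \<open>1\<close>.\<close>
    then have "a \<noteq> b" using graph_dist_le[of 0 n a b] by (auto simp: zero_enat_def[symmetric])
    moreover have "\<not> sg_adj q n a b" using d graph_dist_le[of 1 n a b]
      by (auto simp: eq_OO numeral_eq_enat)
    ultimately show "sg_conductance q (V n - V (n - 1)) a b = (5/3) ^ n * (1/4)" using c by simp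
  qed
qed

end
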